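(* Let $\varepsilon$ be a Rademacher variable taking values $\pm1$ with probability $1/2$ each, independent of the standard Cauchy variable $C$. Then: (i) for every $a\in\mathbb{R}$ with $|a|\ge1$ and for every $\theta\in[-1,1]$, $$aC+\theta\sqrt{1+a^2C^2}\,\varepsilon\stackrel{(d)}{=}\bigl(a+\theta\sqrt{a^2-1}\,\varepsilon\bigr)C;$$ (ii) for every $a,\theta\in[-1,1]$, $$aC+\theta\sqrt{1+a^2C^2}\,\varepsilon\stackrel{(d)}{=}aC+\theta\sqrt{1-a^2}\,\varepsilon.$$
   Context: A standard Cauchy variable $C$ has density $\{\pi(1+x^2)\}^{-1}$, $x\in\mathbb{R}$. The symbol $\stackrel{(d)}{=}$ denotes equality in law. *)

theory Defs
  imports "HOL-Probability.Probability"
begin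

definition std_cauchy_density :: "real \<Rightarrow> real" where
  "std_cauchy_density x = 1 / (pi * (1 + x\<^sup>2))"

definition std_cauchy :: "'a measure \<Rightarrow> ('a \<Rightarrow> real) \<Rightarrow> bool" where
  "std_cauchy M X \<longleftrightarrow> distributed M lborel X (\<lambda>x. ennreal (std_cauchy_density x))"

definition rademacher :: "'a measure \<Rightarrow> ('a \<Rightarrow> real) \<Rightarrow> bool" where
  "rademacher M X \<longleftrightarrow> X \<in> borel_measurable M \<and>
     measure M {\<omega> \<in> space M. X \<omega> = 1} = 1 / 2 \<and>
     measure M {\<omega> \<in> space M. X \<omega> = -1} = 1 / 2"

(* distr is a total function, meaningful as a push-forward only for measurable maps;
   hence measurability is demanded explicitly. *)
definition eq_in_law :: "'a measure \<Rightarrow> ('a \<Rightarrow> real) \<Rightarrow> ('a \<Rightarrow> real) \<Rightarrow> bool" where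
  "eq_in_law M X Y \<longleftrightarrow> X \<in> borel_measurable M \<and> Y \<in> borel_measurable M \<and>
     distr M borel X = distr M borel Y"

end

theory Submission
  imports Defs
begin

text \<open>
  Conditioning on the sign, every distribution function at \<open>t\<close> has the form
  \<open>1 / 2 + (arctan u + arctan v) / (2 * pi)\<close>. For the left-hand side, \<open>a * u\<close> and \<open>a * v\<close> are
  the roots \<open>y\<close> of \<open>(t - y)\<^sup>2 = \<theta>\<^sup>2 * (1 + y\<^sup>2)\<close>, so \<open>u + v\<close> and \<open>u * v\<close> are rational in
  \<open>a\<close>, \<open>\<theta>\<close>, \<open>t\<close>. Since \<open>arctan u + arctan v\<close> is the principal argument of
  \<open>(1 - u * v) + \<i> * (u + v)\<close>, it remains to see that this number differs from the one for the
  right-hand side by a positive factor. This needs \<open>a > 0\<close> and \<open>\<bar>\<theta>\<bar> < 1\<close>; negative \<open>a\<close> is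
  reduced to \<open>-a\<close>, \<open>-\<theta>\<close> by negating both sides, and \<open>\<bar>\<theta>\<bar> = 1\<close> follows by passing to the limit.
\<close>

section \<open>Sums of arctangents, and the equation behind the left-hand side\<close>

lemma arctan_add_arctan_eqI:
  fixes u v u' v' p q :: real
  assumes "p > 0" "q > 0"
    and re: "p * (1 - u * v) = q * (1 - u' * v')"
    and im: "p * (u + v) = q * (u' + v')"
  shows "arctan u + arctan v = arctan u' + arctan v'"
proof -
  \<comment> \<open>The addition formula for the tangent fixes a sum of two arctangents only modulo
    \<open>pi\<close> and breaks down when \<open>x * y = 1\<close>. The argument has neither
    defect: the sum lies strictly between \<open>-pi\<close> and \<open>pi\<close>, and a positive
    factor \<open>r\<close> leaves it unchanged.\<close>
  have Arg_eq: "Arg (Complex (r * (1 - x * y)) (r * (x + y))) = arctan x + arctan y"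
    if "r > 0" for r x y :: real
  proof (rule Arg_unique)
    \<comment> \<open>The modulus of \<open>(1 + \<i> * x) * (1 + \<i> * y)\<close>, whose real and
      imaginary parts are \<open>1 - x * y\<close> and \<open>x + y\<close>.\<close>
    define m where "m = sqrt (1 + x\<^sup>2) * sqrt (1 + y\<^sup>2)"
    have nz: "sqrt (1 + x\<^sup>2) > 0" "sqrt (1 + y\<^sup>2) > 0"
      by (simp_all add: add_pos_nonneg)
    show "r * m > 0" using that nz by (simp add: m_def)
    have "m * cos (arctan x + arctan y) = 1 - x * y"
      using nz by (simp add: m_def cos_add cos_arctan sin_arctan field_simps)
    moreover have "m * sin (arctan x + arctan y) = x + y"
      using nz by (simp add: m_def sin_add cos_arctan sin_arctan field_simps)
    ultimately show "of_real (r * m) * exp (\<i> * of_real (arctan x + arctan y)) =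
        Complex (r * (1 - x * y)) (r * (x + y))"
      by (auto simp: complex_eq_iff Re_exp Im_exp mult.assoc)
    show "- pi < arctan x + arctan y" "arctan x + arctan y \<le> pi"
      using arctan_bounded[of x] arctan_bounded[of y] by auto
  qed
  show ?thesis
    using Arg_eq[OF \<open>p > 0\<close>, of u v] Arg_eq[OF \<open>q > 0\<close>, of u' v'] re im by simp
qed

text \<open>The map \<open>h\<close> sending \<open>y\<close> to
  \<open>y + \<eta> * sqrt (1 + y^2)\<close> is strictly increasing, because the square root is
  1-Lipschitz in \<open>y\<close> and \<open>\<bar>\<eta>\<bar> < 1\<close>. It therefore suffices
  to check that the proposed bound \<open>z\<close> satisfies \<open>h z = t\<close>.\<close>

lemma add_mult_sqrt_le_iff:
  fixes \<eta> y t :: real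
  assumes "\<bar>\<eta>\<bar> < 1"
  shows "y + \<eta> * sqrt (1 + y\<^sup>2) \<le> t \<longleftrightarrow> y \<le> (t - \<eta> * sqrt (1 - \<eta>\<^sup>2 + t\<^sup>2)) / (1 - \<eta>\<^sup>2)"
proof -
  define h where "h = (\<lambda>y. y + \<eta> * sqrt (1 + y\<^sup>2))"
  define R where "R = sqrt (1 - \<eta>\<^sup>2 + t\<^sup>2)"
  define z where "z = (t - \<eta> * R) / (1 - \<eta>\<^sup>2)"
  have eta: "\<eta>\<^sup>2 < 1" using assms by (simp add: abs_square_less_1)
  have h_mono: "h x < h y" if "x < y" for x y
  proof -
    \<comment> \<open>The triangle inequality for the plane vectors \<open>(1, c)\<close> and
      \<open>(0, b - c)\<close>.\<close>
    have *: "sqrt (1 + b\<^sup>2) \<le> sqrt (1 + c\<^sup>2) + \<bar>b - c\<bar>" for b c :: real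
      using real_sqrt_sum_squares_triangle_ineq[of 1 0 c "b - c"] by simp
    have "\<bar>\<eta> * (sqrt (1 + y\<^sup>2) - sqrt (1 + x\<^sup>2))\<bar> \<le> \<bar>\<eta>\<bar> * (y - x)"
      unfolding abs_mult using *[of x y] *[of y x] that
      by (intro mult_left_mono) auto
    also have "\<dots> < y - x" using assms that by simp
    finally show ?thesis by (simp add: h_def algebra_simps)
  qed
  \<comment> \<open>For nonzero \<eta> the right-hand side is \<open>(t - z) / \<eta>\<close>, the
    value that \<open>h z = t\<close> forces. The squares agree because
    \<open>R^2 - t^2 = 1 - \<eta>^2\<close>; the sign, which squaring loses, is settled by
    \<open>\<eta> * t \<le> \<bar>t\<bar> \<le> R\<close>.\<close>
  have "sqrt (1 + z\<^sup>2) = (R - \<eta> * t) / (1 - \<eta>\<^sup>2)"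
  proof (rule real_sqrt_unique)
    have R2: "R\<^sup>2 = 1 - \<eta>\<^sup>2 + t\<^sup>2" using eta by (simp add: R_def)
    have "(R - \<eta> * t)\<^sup>2 = (1 - \<eta>\<^sup>2)\<^sup>2 + (t - \<eta> * R)\<^sup>2"
      using R2 by algebra
    then show "((R - \<eta> * t) / (1 - \<eta>\<^sup>2))\<^sup>2 = 1 + z\<^sup>2"
      using eta by (simp add: z_def power_divide field_simps)
    have "\<eta> * t \<le> \<bar>\<eta>\<bar> * \<bar>t\<bar>" by (metis abs_ge_self abs_mult)
    also have "\<dots> \<le> \<bar>t\<bar>" using assms by (simp add: mult_left_le_one_le)
    also have "\<dots> \<le> R" unfolding R_def using eta by (intro real_le_rsqrt) simp
    finally show "0 \<le> (R - \<eta> * t) / (1 - \<eta>\<^sup>2)" using eta by simp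
  qed
  then have "h z = (t - \<eta> * R) / (1 - \<eta>\<^sup>2) + \<eta> * ((R - \<eta> * t) / (1 - \<eta>\<^sup>2))"
    by (simp add: h_def z_def)
  also have "\<dots> = (t * (1 - \<eta>\<^sup>2)) / (1 - \<eta>\<^sup>2)"
    by (simp add: add_divide_distrib[symmetric] algebra_simps power2_eq_square)
  also have "\<dots> = t" using eta by simp
  finally have "h y \<le> t \<longleftrightarrow> y \<le> z"
    using h_mono[of y z] h_mono[of z y] by (cases y z rule: linorder_cases) auto
  then show ?thesis by (simp add: h_def z_def R_def)
qed

text \<open>These are Vieta's formulas for
  \<open>(1 - \<theta>^2) * y^2 - 2 * t * y + (t^2 - \<theta>^2) = 0\<close>, the expanded form of
  \<open>(t - y)^2 = \<theta>^2 * (1 + y^2)\<close>. The square root in \<open>r\<close> is the same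
  for \<theta> and \<open>-\<theta>\<close>, so it cancels from both the sum and the
  product.\<close>

lemma add_mult_sqrt_root_sum_prod:
  fixes \<theta> t :: real
  assumes "\<bar>\<theta>\<bar> < 1"
  defines "r \<equiv> \<lambda>\<eta>. (t - \<eta> * sqrt (1 - \<eta>\<^sup>2 + t\<^sup>2)) / (1 - \<eta>\<^sup>2)"
  shows "(1 - \<theta>\<^sup>2) * (r \<theta> + r (-\<theta>)) = 2 * t"
    and "(1 - \<theta>\<^sup>2) * (r \<theta> * r (-\<theta>)) = t\<^sup>2 - \<theta>\<^sup>2"
proof -
  have nz: "1 - \<theta>\<^sup>2 > 0" using assms(1) by (simp add: abs_square_less_1)
  define R where "R = sqrt (1 - \<theta>\<^sup>2 + t\<^sup>2)"
  have R2: "R\<^sup>2 = 1 - \<theta>\<^sup>2 + t\<^sup>2" using nz by (simp add: R_def)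
  have r: "(1 - \<theta>\<^sup>2) * r \<theta> = t - \<theta> * R" "(1 - \<theta>\<^sup>2) * r (-\<theta>) = t + \<theta> * R"
    using nz by (simp_all add: r_def R_def)
  show "(1 - \<theta>\<^sup>2) * (r \<theta> + r (-\<theta>)) = 2 * t"
    using r by (simp add: distrib_left)
  have "(1 - \<theta>\<^sup>2) * ((1 - \<theta>\<^sup>2) * (r \<theta> * r (-\<theta>))) = (1 - \<theta>\<^sup>2) * (t\<^sup>2 - \<theta>\<^sup>2)"
    using r R2 by algebra
  then show "(1 - \<theta>\<^sup>2) * (r \<theta> * r (-\<theta>)) = t\<^sup>2 - \<theta>\<^sup>2" using nz by simp
qed

section \<open>Distribution functions, mixing over the sign, and limits of equalities in law\<close>

context prob_space
begin

lemma prob_std_cauchy_le: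
  assumes "std_cauchy M C"
  shows "prob {\<omega> \<in> space M. C \<omega> \<le> q} = 1 / 2 + arctan q / pi"
proof -
  have D: "distributed M lborel C (\<lambda>x. ennreal (std_cauchy_density x))"
    using assms by (simp add: std_cauchy_def)
  have meas: "C \<in> borel_measurable M"
    using distributed_measurable[OF D] by simp
  have "((\<lambda>x. arctan x / pi) \<longlongrightarrow> (pi / 2) / pi) at_top"
    by (intro tendsto_intros tendsto_arctan_at_top) simp
  then have lim: "((\<lambda>x. arctan x / pi) \<longlongrightarrow> 1 / 2) at_top" by simp
  have pos: "1 + x\<^sup>2 > 0" for x :: real by (simp add: add_pos_nonneg)
  \<comment> \<open>The upper tail is integrated, from the limit of the antiderivative at infinity,
    and the claim follows by taking complements. Closing the half-line at \<open>q\<close> changes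
    only a null set.\<close>
  have "emeasure M (C -` {q<..} \<inter> space M) =
      (\<integral>\<^sup>+x. ennreal (std_cauchy_density x) * indicator {q<..} x \<partial>lborel)"
    by (rule distributed_emeasure[OF D]) simp
  also have "\<dots> = (\<integral>\<^sup>+x. ennreal (std_cauchy_density x) * indicator {q..} x \<partial>lborel)"
    using AE_lborel_singleton[of q]
    by (intro nn_integral_cong_AE, eventually_elim) (auto split: split_indicator)
  also have "\<dots> = ennreal (1 / 2 - arctan q / pi)"
  proof (rule nn_integral_FTC_atLeast[OF _ _ _ lim])
    show "std_cauchy_density \<in> borel_measurable borel"
      unfolding std_cauchy_density_def[abs_def] by measurable
    show "((\<lambda>x. arctan x / pi) has_real_derivative std_cauchy_density x) (at x)" for x
      using pos[of x] by (auto intro!: derivative_eq_intros simp: std_cauchy_density_def divide_inverse mult.commute)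
    show "0 \<le> std_cauchy_density x" for x
      using pos[of x] by (simp add: std_cauchy_density_def less_imp_le)
  qed
  finally have "prob (C -` {q<..} \<inter> space M) = 1 / 2 - arctan q / pi"
    using arctan_ubound[of q] pi_gt_zero by (simp add: measure_def field_simps)
  moreover have "C -` {q<..} \<inter> space M = {\<omega> \<in> space M. \<not> C \<omega> \<le> q}" by auto
  ultimately show ?thesis using meas prob_neg[of "\<lambda>\<omega>. C \<omega> \<le> q"] by simp
qed

text \<open>On the event \<open>\<epsilon> = e\<close> the condition involves \<open>X\<close>
  alone, so it is the preimage of a rectangle and independence splits off the factor 1/2.\<close>

lemma prob_indep_rademacher:
  assumes ind: "indep_var borel X borel \<epsilon>" and rad: "rademacher M \<epsilon>"
    and P[measurable]: "Measurable.pred (borel \<Otimes>\<^sub>M borel) (\<lambda>(x, e). P x e)"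
  shows "prob {\<omega> \<in> space M. P (X \<omega>) (\<epsilon> \<omega>)} =
    (prob {\<omega> \<in> space M. P (X \<omega>) 1} + prob {\<omega> \<in> space M. P (X \<omega>) (-1)}) / 2"
proof -
  have [measurable]: "X \<in> borel_measurable M" "\<epsilon> \<in> borel_measurable M"
    using ind by (auto dest: indep_var_rv1 indep_var_rv2)
  have [measurable]: "Measurable.pred borel (\<lambda>x. P x e)" for e
  proof -
    have "Measurable.pred borel (\<lambda>x. case (x, e) of (x, e) \<Rightarrow> P x e)" by measurable
    then show ?thesis by simp
  qed
  have half: "prob {\<omega> \<in> space M. \<epsilon> \<omega> = e} = 1 / 2" if "e \<in> {1, -1}" for e
    using that rad by (auto simp: rademacher_def)
  have product: "prob {\<omega> \<in> space M. P (X \<omega>) (\<epsilon> \<omega>) \<and> \<epsilon> \<omega> = e} =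
      prob {\<omega> \<in> space M. P (X \<omega>) e} / 2" if "e \<in> {1, -1}" for e
  proof -
    have "prob ((\<lambda>\<omega>. (X \<omega>, \<epsilon> \<omega>)) -` ({x. P x e} \<times> {e}) \<inter> space M) =
        prob (X -` {x. P x e} \<inter> space M) * prob (\<epsilon> -` {e} \<inter> space M)"
      by (rule indep_varD[OF ind]) (auto simp: pred_def)
    moreover have "(\<lambda>\<omega>. (X \<omega>, \<epsilon> \<omega>)) -` ({x. P x e} \<times> {e}) \<inter> space M =
        {\<omega> \<in> space M. P (X \<omega>) (\<epsilon> \<omega>) \<and> \<epsilon> \<omega> = e}"
      "X -` {x. P x e} \<inter> space M = {\<omega> \<in> space M. P (X \<omega>) e}"
      "\<epsilon> -` {e} \<inter> space M = {\<omega> \<in> space M. \<epsilon> \<omega> = e}" by auto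
    ultimately show ?thesis using half[OF that] by simp
  qed
  \<comment> \<open>The definition of \<open>rademacher\<close> prescribes only two point
    probabilities. As they add up to 1, all other values have probability zero.\<close>
  have "prob {\<omega> \<in> space M. \<epsilon> \<omega> = 1 \<or> \<epsilon> \<omega> = -1} =
      prob {\<omega> \<in> space M. \<epsilon> \<omega> = 1} + prob {\<omega> \<in> space M. \<epsilon> \<omega> = -1}"
    by (subst finite_measure_Union[symmetric]) (auto intro!: arg_cong[where f = prob])
  then have "AE \<omega> in M. \<epsilon> \<omega> = 1 \<or> \<epsilon> \<omega> = -1"
    using half by (subst prob_Collect_eq_1[symmetric]) auto
  then have "prob {\<omega> \<in> space M. P (X \<omega>) (\<epsilon> \<omega>)} =
      prob ({\<omega> \<in> space M. P (X \<omega>) (\<epsilon> \<omega>) \<and> \<epsilon> \<omega> = 1} \<union>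
        {\<omega> \<in> space M. P (X \<omega>) (\<epsilon> \<omega>) \<and> \<epsilon> \<omega> = -1})"
    by (intro finite_measure_eq_AE) auto
  also have "\<dots> = prob {\<omega> \<in> space M. P (X \<omega>) (\<epsilon> \<omega>) \<and> \<epsilon> \<omega> = 1} +
      prob {\<omega> \<in> space M. P (X \<omega>) (\<epsilon> \<omega>) \<and> \<epsilon> \<omega> = -1}"
    by (intro finite_measure_Union) auto
  finally show ?thesis by (simp add: product)
qed

lemma eq_in_lawI_prob_le:
  assumes [measurable]: "X \<in> borel_measurable M" "Y \<in> borel_measurable M"
    and "\<And>t. prob {\<omega> \<in> space M. X \<omega> \<le> t} = prob {\<omega> \<in> space M. Y \<omega> \<le> t}"
  shows "eq_in_law M X Y"
  unfolding eq_in_law_def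
proof (intro conjI assms(1,2) cdf_unique)
  show "cdf (distr M borel X) = cdf (distr M borel Y)"
    using assms(3) by (auto simp: fun_eq_iff cdf_def measure_distr vimage_def Int_def conj_commute)
qed auto

text \<open>Distribution functions may fail to converge at atoms of the limit, so characteristic
  functions are used: they converge at every point by dominated convergence with bound 1, and they
  determine the law by Levy's uniqueness theorem.\<close>

lemma eq_in_law_tendsto:
  assumes eq: "\<And>n. eq_in_law M (X n) (Y n)"
    and lim: "\<And>\<omega>. (\<lambda>n. X n \<omega>) \<longlonglongrightarrow> X' \<omega>" "\<And>\<omega>. (\<lambda>n. Y n \<omega>) \<longlonglongrightarrow> Y' \<omega>"
  shows "eq_in_law M X' Y'"
proof -
  have [measurable]: "X n \<in> borel_measurable M" "Y n \<in> borel_measurable M" for n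
    using eq[of n] by (auto simp: eq_in_law_def)
  have [measurable]: "X' \<in> borel_measurable M"
    by (rule borel_measurable_LIMSEQ_metric[OF _ lim(1)]) measurable
  have [measurable]: "Y' \<in> borel_measurable M"
    by (rule borel_measurable_LIMSEQ_metric[OF _ lim(2)]) measurable
  have char_tendsto: "(\<lambda>n. char (distr M borel (Z n)) t) \<longlonglongrightarrow> char (distr M borel Z') t"
    if [measurable]: "\<And>n. Z n \<in> borel_measurable M" "Z' \<in> borel_measurable M"
      and "\<And>\<omega>. (\<lambda>n. Z n \<omega>) \<longlonglongrightarrow> Z' \<omega>" for Z Z' t
  proof -
    have "(\<lambda>n. CLINT \<omega>|M. iexp (t * Z n \<omega>)) \<longlonglongrightarrow> (CLINT \<omega>|M. iexp (t * Z' \<omega>))"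
      by (rule integral_dominated_convergence[where w = "\<lambda>_. 1"])
        (auto intro!: AE_I2 tendsto_intros that(3))
    then show ?thesis by (simp add: char_def integral_distr)
  qed
  have "char (distr M borel X') = char (distr M borel Y')"
  proof
    fix t
    have "(\<lambda>n. char (distr M borel (X n)) t) \<longlonglongrightarrow> char (distr M borel X') t"
      by (rule char_tendsto) (auto intro: lim)
    moreover have "(\<lambda>n. char (distr M borel (X n)) t) \<longlonglongrightarrow> char (distr M borel Y') t"
      using char_tendsto[of Y Y' t] eq lim(2) by (simp add: eq_in_law_def)
    ultimately show "char (distr M borel X') t = char (distr M borel Y') t"
      by (rule LIMSEQ_unique)
  qed
  then have "distr M borel X' = distr M borel Y'"
    by (intro Levy_uniqueness) auto
  then show ?thesis by (simp add: eq_in_law_def)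
qed

text \<open>This adds the endpoints \<open>\<bar>\<theta>\<bar> = 1\<close>, at which the
  denominator \<open>1 - \<theta>^2\<close> of the roots vanishes.\<close>

lemma eq_in_law_closure:
  fixes f g :: "real \<Rightarrow> 'a \<Rightarrow> real"
  assumes \<theta>: "\<bar>\<theta>\<bar> \<le> 1"
    and eq: "\<And>\<theta>. \<bar>\<theta>\<bar> < 1 \<Longrightarrow> eq_in_law M (f \<theta>) (g \<theta>)"
    and cont: "\<And>\<omega>. isCont (\<lambda>\<theta>. f \<theta> \<omega>) \<theta>" "\<And>\<omega>. isCont (\<lambda>\<theta>. g \<theta> \<omega>) \<theta>"
  shows "eq_in_law M (f \<theta>) (g \<theta>)"
proof (rule eq_in_law_tendsto)
  \<comment> \<open>Shrinking by \<open>n / (n + 1)\<close> moves every point of the closed interval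
    into the open one, so both endpoints are handled at once.\<close>
  define s where "s n = \<theta> * (real n / real (Suc n))" for n
  have "(\<lambda>n. \<theta> * (real n / real (Suc n))) \<longlonglongrightarrow> \<theta> * 1"
    by (intro tendsto_mult tendsto_const LIMSEQ_n_over_Suc_n)
  then have "s \<longlonglongrightarrow> \<theta>" by (simp add: s_def[abs_def])
  then show "(\<lambda>n. f (s n) \<omega>) \<longlonglongrightarrow> f \<theta> \<omega>" "(\<lambda>n. g (s n) \<omega>) \<longlonglongrightarrow> g \<theta> \<omega>" for \<omega>
    using cont by (auto intro: isCont_tendsto_compose)
  show "eq_in_law M (f (s n)) (g (s n))" for n
  proof (rule eq)
    have "\<bar>s n\<bar> = \<bar>\<theta>\<bar> * (real n / real (Suc n))"
      by (simp add: s_def abs_mult)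
    also have "\<dots> \<le> real n / real (Suc n)" using \<theta> by (intro mult_left_le_one_le) auto
    also have "\<dots> < 1" by simp
    finally show "\<bar>s n\<bar> < 1" .
  qed
qed

lemma eq_in_law_uminus:
  assumes "eq_in_law M X Y"
  shows "eq_in_law M (\<lambda>\<omega>. - X \<omega>) (\<lambda>\<omega>. - Y \<omega>)"
proof -
  have [measurable]: "X \<in> borel_measurable M" "Y \<in> borel_measurable M"
    and eq: "distr M borel X = distr M borel Y"
    using assms by (auto simp: eq_in_law_def)
  have "distr (distr M borel X) borel uminus = distr (distr M borel Y) borel uminus"
    by (simp only: eq)
  then show ?thesis by (simp add: eq_in_law_def distr_distr o_def)
qed

text \<open>The common frame of both identities. For a fixed sign \<open>e\<close>, the numbers
  \<open>u t e\<close> and \<open>v t e\<close> are the thresholds for \<open>C\<close> at level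
  \<open>t\<close>. Averaging over the sign leaves a sum of two arctangents on each side, so only
  the sums and products of the thresholds have to be compared, up to the positive factors
  \<open>p\<close> and \<open>q\<close>.\<close>

lemma eq_in_law_cauchy_rademacherI:
  assumes C: "std_cauchy M C" and rad: "rademacher M \<epsilon>"
    and ind: "indep_var borel C borel \<epsilon>"
    and [measurable]: "(\<lambda>(x, e). g x e) \<in> borel_measurable (borel \<Otimes>\<^sub>M borel)"
      "(\<lambda>(x, e). h x e) \<in> borel_measurable (borel \<Otimes>\<^sub>M borel)"
    and g: "\<And>x e t. e \<in> {1, -1} \<Longrightarrow> g x e \<le> t \<longleftrightarrow> x \<le> u t e"
    and h: "\<And>x e t. e \<in> {1, -1} \<Longrightarrow> h x e \<le> t \<longleftrightarrow> x \<le> v t e"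
    and "p > 0" "q > 0"
    and "\<And>t. p * (1 - u t 1 * u t (-1)) = q * (1 - v t 1 * v t (-1))"
    and "\<And>t. p * (u t 1 + u t (-1)) = q * (v t 1 + v t (-1))"
  shows "eq_in_law M (\<lambda>\<omega>. g (C \<omega>) (\<epsilon> \<omega>)) (\<lambda>\<omega>. h (C \<omega>) (\<epsilon> \<omega>))"
proof (rule eq_in_lawI_prob_le)
  have [measurable]: "C \<in> borel_measurable M" "\<epsilon> \<in> borel_measurable M"
    using ind by (auto dest: indep_var_rv1 indep_var_rv2)
  show "(\<lambda>\<omega>. g (C \<omega>) (\<epsilon> \<omega>)) \<in> borel_measurable M" "(\<lambda>\<omega>. h (C \<omega>) (\<epsilon> \<omega>)) \<in> borel_measurable M"
    by measurable
  show "prob {\<omega> \<in> space M. g (C \<omega>) (\<epsilon> \<omega>) \<le> t} = prob {\<omega> \<in> space M. h (C \<omega>) (\<epsilon> \<omega>) \<le> t}" for t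
  proof -
    have "arctan (u t 1) + arctan (u t (-1)) = arctan (v t 1) + arctan (v t (-1))"
      by (rule arctan_add_arctan_eqI) fact+
    moreover have "prob {\<omega> \<in> space M. g (C \<omega>) (\<epsilon> \<omega>) \<le> t} =
        1 / 2 + (arctan (u t 1) + arctan (u t (-1))) / (2 * pi)"
      by (subst prob_indep_rademacher[OF ind rad])
        (simp_all add: g prob_std_cauchy_le[OF C] field_simps)
    moreover have "prob {\<omega> \<in> space M. h (C \<omega>) (\<epsilon> \<omega>) \<le> t} =
        1 / 2 + (arctan (v t 1) + arctan (v t (-1))) / (2 * pi)"
      by (subst prob_indep_rademacher[OF ind rad])
        (simp_all add: h prob_std_cauchy_le[OF C] field_simps)
    ultimately show ?thesis by simp
  qed
qed

end

section \<open>The two identities for positive \<open>a\<close> and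
  \<open>\<bar>\<theta>\<bar> < 1\<close>\<close>

lemma mult_add_mult_sqrt_le_iff:
  fixes a \<eta> x t :: real
  assumes "a > 0" "\<bar>\<eta>\<bar> < 1"
  shows "a * x + \<eta> * sqrt (1 + a\<^sup>2 * x\<^sup>2) \<le> t \<longleftrightarrow>
    x \<le> (t - \<eta> * sqrt (1 - \<eta>\<^sup>2 + t\<^sup>2)) / (1 - \<eta>\<^sup>2) / a"
  using add_mult_sqrt_le_iff[OF assms(2), of "a * x" t] assms(1)
  by (simp add: pos_le_divide_eq[OF assms(1)] power_mult_distrib mult.commute[of x]
      del: divide_divide_eq_left)

locale cauchy_rademacher = prob_space +
  fixes C \<epsilon> :: "'a \<Rightarrow> real"
  assumes C: "std_cauchy M C" and rad: "rademacher M \<epsilon>"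
    and ind: "indep_var borel C borel \<epsilon>"
begin

lemma eq_in_law_scaled_pos:
  assumes a: "a \<ge> 1" and \<theta>: "\<bar>\<theta>\<bar> < 1"
  shows "eq_in_law M (\<lambda>\<omega>. a * C \<omega> + \<theta> * sqrt (1 + a\<^sup>2 * (C \<omega>)\<^sup>2) * \<epsilon> \<omega>)
    (\<lambda>\<omega>. (a + \<theta> * sqrt (a\<^sup>2 - 1) * \<epsilon> \<omega>) * C \<omega>)"
proof -
  define r where "r t \<eta> = (t - \<eta> * sqrt (1 - \<eta>\<^sup>2 + t\<^sup>2)) / (1 - \<eta>\<^sup>2)" for t \<eta> :: real
  define c where "c e = a + \<theta> * sqrt (a\<^sup>2 - 1) * e" for e :: real
  have \<theta>2: "1 - \<theta>\<^sup>2 > 0" using \<theta> by (simp add: abs_square_less_1)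
  \<comment> \<open>Both values of the random factor on the right are positive, so dividing by them
    preserves the inequality that defines the threshold.\<close>
  have "\<bar>\<theta> * sqrt (a\<^sup>2 - 1)\<bar> \<le> sqrt (a\<^sup>2 - 1)"
    using \<theta> a by (simp add: abs_mult mult_left_le_one_le)
  also have "\<dots> < a" using a by (intro real_less_lsqrt) auto
  finally have c_pos: "c e > 0" if "e \<in> {1, -1}" for e
    using that by (auto simp: c_def)
  have "a\<^sup>2 \<ge> 1" using a by simp
  then have c_prod: "c 1 * c (-1) = a\<^sup>2 - \<theta>\<^sup>2 * (a\<^sup>2 - 1)"
    by (simp add: c_def algebra_simps power2_eq_square)
  have c_sum: "c 1 + c (-1) = 2 * a" by (simp add: c_def)
  \<comment> \<open>The factors \<open>p\<close> and \<open>q\<close> clear the denominators. Both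
    sides then give the complex number with real part
    \<open>a^2 * (1 - \<theta>^2) + \<theta>^2 - t^2\<close> and imaginary part
    \<open>2 * a * t\<close>; on the right this uses \<open>c_prod\<close> and
    \<open>c_sum\<close>.\<close>
  show ?thesis
    unfolding c_def[symmetric]
  proof (rule eq_in_law_cauchy_rademacherI[OF C rad ind,
        where g = "\<lambda>x e. a * x + \<theta> * sqrt (1 + a\<^sup>2 * x\<^sup>2) * e" and h = "\<lambda>x e. c e * x"
          and u = "\<lambda>t e. r t (\<theta> * e) / a" and v = "\<lambda>t e. t / c e"
          and p = "a\<^sup>2 * (1 - \<theta>\<^sup>2)" and q = "c 1 * c (-1)"])
    show "a * x + \<theta> * sqrt (1 + a\<^sup>2 * x\<^sup>2) * e \<le> t \<longleftrightarrow> x \<le> r t (\<theta> * e) / a"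
      if "e \<in> {1, -1}" for x e t
      using mult_add_mult_sqrt_le_iff[of a "\<theta> * e" x t] that a \<theta> by (auto simp: r_def mult_ac)
    show "c e * x \<le> t \<longleftrightarrow> x \<le> t / c e" if "e \<in> {1, -1}" for x e t
      using c_pos[OF that] by (simp add: field_simps)
    show "a\<^sup>2 * (1 - \<theta>\<^sup>2) > 0" using a \<theta>2 by simp
    show "c 1 * c (-1) > 0" using c_pos by simp
    fix t :: real
    note root = add_mult_sqrt_root_sum_prod[OF \<theta>, of t, folded r_def]
    have "a\<^sup>2 * (1 - \<theta>\<^sup>2) * (1 - r t (\<theta> * 1) / a * (r t (\<theta> * -1) / a)) =
        a\<^sup>2 * (1 - \<theta>\<^sup>2) - (1 - \<theta>\<^sup>2) * (r t \<theta> * r t (-\<theta>))"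
      using a by (simp add: field_simps power2_eq_square)
    also have "\<dots> = c 1 * c (-1) - t\<^sup>2" unfolding root c_prod by (simp add: algebra_simps)
    also have "\<dots> = c 1 * c (-1) * (1 - t / c 1 * (t / c (-1)))"
      using c_pos[of 1] c_pos[of "-1"] by (simp add: field_simps power2_eq_square)
    finally show "a\<^sup>2 * (1 - \<theta>\<^sup>2) * (1 - r t (\<theta> * 1) / a * (r t (\<theta> * -1) / a)) = \<dots>" .
    have "a\<^sup>2 * (1 - \<theta>\<^sup>2) * (r t (\<theta> * 1) / a + r t (\<theta> * -1) / a) =
        a * ((1 - \<theta>\<^sup>2) * (r t \<theta> + r t (-\<theta>)))"
      using a by (simp add: field_simps power2_eq_square)
    also have "\<dots> = t * (c 1 + c (-1))" unfolding root c_sum by simp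
    also have "\<dots> = c 1 * c (-1) * (t / c 1 + t / c (-1))"
      using c_pos[of 1] c_pos[of "-1"] by (simp add: field_simps)
    finally show "a\<^sup>2 * (1 - \<theta>\<^sup>2) * (r t (\<theta> * 1) / a + r t (\<theta> * -1) / a) = \<dots>" .
  qed (auto simp: c_def)
qed

text \<open>The left-hand side yields the same complex number as for \<open>a \<ge> 1\<close>. Now
  \<open>1 - a^2\<close> is the quantity with a real square root, and the number is matched by two
  thresholds shifted by \<open>d\<close> in opposite directions: their sum does not involve
  \<open>d\<close>, and \<open>d^2 = \<theta>^2 * (1 - a^2)\<close> adjusts their product.\<close>

lemma eq_in_law_shifted_pos:
  assumes a: "0 < a" "a \<le> 1" and \<theta>: "\<bar>\<theta>\<bar> < 1"
  shows "eq_in_law M (\<lambda>\<omega>. a * C \<omega> + \<theta> * sqrt (1 + a\<^sup>2 * (C \<omega>)\<^sup>2) * \<epsilon> \<omega>)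
    (\<lambda>\<omega>. a * C \<omega> + \<theta> * sqrt (1 - a\<^sup>2) * \<epsilon> \<omega>)"
proof -
  define r where "r t \<eta> = (t - \<eta> * sqrt (1 - \<eta>\<^sup>2 + t\<^sup>2)) / (1 - \<eta>\<^sup>2)" for t \<eta> :: real
  define d where "d = \<theta> * sqrt (1 - a\<^sup>2)"
  have \<theta>2: "1 - \<theta>\<^sup>2 > 0" using \<theta> by (simp add: abs_square_less_1)
  have "a\<^sup>2 \<le> 1" using a by (simp add: power_le_one)
  then have d2: "d\<^sup>2 = \<theta>\<^sup>2 * (1 - a\<^sup>2)" by (simp add: d_def power_mult_distrib)
  show ?thesis
    unfolding d_def[symmetric]
  proof (rule eq_in_law_cauchy_rademacherI[OF C rad ind,
        where g = "\<lambda>x e. a * x + \<theta> * sqrt (1 + a\<^sup>2 * x\<^sup>2) * e" and h = "\<lambda>x e. a * x + d * e"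
          and u = "\<lambda>t e. r t (\<theta> * e) / a" and v = "\<lambda>t e. (t - d * e) / a"
          and p = "a\<^sup>2 * (1 - \<theta>\<^sup>2)" and q = "a\<^sup>2"])
    show "a * x + \<theta> * sqrt (1 + a\<^sup>2 * x\<^sup>2) * e \<le> t \<longleftrightarrow> x \<le> r t (\<theta> * e) / a"
      if "e \<in> {1, -1}" for x e t
      using mult_add_mult_sqrt_le_iff[of a "\<theta> * e" x t] that a \<theta> by (auto simp: r_def mult_ac)
    show "a * x + d * e \<le> t \<longleftrightarrow> x \<le> (t - d * e) / a" for x e t
      using a by (simp add: field_simps)
    show "a\<^sup>2 * (1 - \<theta>\<^sup>2) > 0" "a\<^sup>2 > 0" using a \<theta>2 by simp_all
    fix t :: real
    note root = add_mult_sqrt_root_sum_prod[OF \<theta>, of t, folded r_def]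
    have "a\<^sup>2 * (1 - \<theta>\<^sup>2) * (1 - r t (\<theta> * 1) / a * (r t (\<theta> * -1) / a)) =
        a\<^sup>2 * (1 - \<theta>\<^sup>2) - (1 - \<theta>\<^sup>2) * (r t \<theta> * r t (-\<theta>))"
      using a by (simp add: field_simps power2_eq_square)
    also have "\<dots> = a\<^sup>2 - (t\<^sup>2 - d\<^sup>2)" unfolding root d2 by (simp add: algebra_simps)
    also have "\<dots> = a\<^sup>2 * (1 - (t - d * 1) / a * ((t - d * -1) / a))"
      using a by (simp add: field_simps power2_eq_square)
    finally show "a\<^sup>2 * (1 - \<theta>\<^sup>2) * (1 - r t (\<theta> * 1) / a * (r t (\<theta> * -1) / a)) = \<dots>" .
    have "a\<^sup>2 * (1 - \<theta>\<^sup>2) * (r t (\<theta> * 1) / a + r t (\<theta> * -1) / a) =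
        a * ((1 - \<theta>\<^sup>2) * (r t \<theta> + r t (-\<theta>)))"
      using a by (simp add: field_simps power2_eq_square)
    also have "\<dots> = a\<^sup>2 * ((t - d * 1) / a + (t - d * -1) / a)"
      unfolding root using a by (simp add: field_simps power2_eq_square)
    finally show "a\<^sup>2 * (1 - \<theta>\<^sup>2) * (r t (\<theta> * 1) / a + r t (\<theta> * -1) / a) = \<dots>" .
  qed auto
qed

section \<open>Extension to negative \<open>a\<close> and to
  \<open>\<bar>\<theta>\<bar> = 1\<close>\<close>

lemma eq_in_law_scaled:
  assumes "\<bar>a\<bar> \<ge> 1" "\<bar>\<theta>\<bar> \<le> 1"
  shows "eq_in_law M (\<lambda>\<omega>. a * C \<omega> + \<theta> * sqrt (1 + a\<^sup>2 * (C \<omega>)\<^sup>2) * \<epsilon> \<omega>)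
    (\<lambda>\<omega>. (a + \<theta> * sqrt (a\<^sup>2 - 1) * \<epsilon> \<omega>) * C \<omega>)"
proof -
  have pos: "eq_in_law M (\<lambda>\<omega>. a * C \<omega> + \<theta> * sqrt (1 + a\<^sup>2 * (C \<omega>)\<^sup>2) * \<epsilon> \<omega>)
      (\<lambda>\<omega>. (a + \<theta> * sqrt (a\<^sup>2 - 1) * \<epsilon> \<omega>) * C \<omega>)" if "a \<ge> 1" "\<bar>\<theta>\<bar> \<le> 1" for a \<theta>
    by (rule eq_in_law_closure[OF that(2)])
      (auto intro!: eq_in_law_scaled_pos that(1) continuous_intros)
  show ?thesis
  proof (cases "a \<ge> 1")
    case True
    then show ?thesis using assms(2) by (rule pos)
  next
    case False
    \<comment> \<open>Here \<open>a \<le> -1\<close>. Both sides are odd under changing the signs of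
      \<open>a\<close> and \<theta> together, since \<open>a\<close> enters the square roots only
      through its square.\<close>
    then show ?thesis
      using eq_in_law_uminus[OF pos[of "-a" "-\<theta>"]] assms by (simp add: algebra_simps)
  qed
qed

lemma eq_in_law_shifted:
  assumes "\<bar>a\<bar> \<le> 1" "\<bar>\<theta>\<bar> \<le> 1"
  shows "eq_in_law M (\<lambda>\<omega>. a * C \<omega> + \<theta> * sqrt (1 + a\<^sup>2 * (C \<omega>)\<^sup>2) * \<epsilon> \<omega>)
    (\<lambda>\<omega>. a * C \<omega> + \<theta> * sqrt (1 - a\<^sup>2) * \<epsilon> \<omega>)"
proof -
  have pos: "eq_in_law M (\<lambda>\<omega>. a * C \<omega> + \<theta> * sqrt (1 + a\<^sup>2 * (C \<omega>)\<^sup>2) * \<epsilon> \<omega>)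
      (\<lambda>\<omega>. a * C \<omega> + \<theta> * sqrt (1 - a\<^sup>2) * \<epsilon> \<omega>)" if "0 < a" "a \<le> 1" "\<bar>\<theta>\<bar> \<le> 1" for a \<theta>
    by (rule eq_in_law_closure[OF that(3)])
      (auto intro!: eq_in_law_shifted_pos that(1,2) continuous_intros)
  consider "a > 0" | "a = 0" | "a < 0" by linarith
  then show ?thesis
  proof cases
    case 1
    then show ?thesis using assms by (intro pos) auto
  next
    case 2
    \<comment> \<open>The thresholds involve division by \<open>a\<close>, so this case is separate:
      both sides reduce to \<open>\<theta> * \<epsilon>\<close>, and only measurability
      remains.\<close>
    have [measurable]: "\<epsilon> \<in> borel_measurable M" using rad by (simp add: rademacher_def)
    show ?thesis using 2 by (simp add: eq_in_law_def)
  next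
    case 3
    then show ?thesis
      using eq_in_law_uminus[OF pos[of "-a" "-\<theta>"]] assms by (simp add: algebra_simps)
  qed
qed

end

theorem theorem1p3:
  fixes M :: "'a measure" and C \<epsilon> :: "'a \<Rightarrow> real"
  assumes "prob_space M"
    and "std_cauchy M C"
    and "rademacher M \<epsilon>"
    and "prob_space.indep_var M borel C borel \<epsilon>"
  shows "(\<forall>a \<theta> :: real. \<bar>a\<bar> \<ge> 1 \<longrightarrow> \<theta> \<in> {-1..1} \<longrightarrow>
           eq_in_law M (\<lambda>\<omega>. a * C \<omega> + \<theta> * sqrt (1 + a\<^sup>2 * (C \<omega>)\<^sup>2) * \<epsilon> \<omega>)
                       (\<lambda>\<omega>. (a + \<theta> * sqrt (a\<^sup>2 - 1) * \<epsilon> \<omega>) * C \<omega>)) \<and>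
         (\<forall>a \<theta> :: real. a \<in> {-1..1} \<longrightarrow> \<theta> \<in> {-1..1} \<longrightarrow>
           eq_in_law M (\<lambda>\<omega>. a * C \<omega> + \<theta> * sqrt (1 + a\<^sup>2 * (C \<omega>)\<^sup>2) * \<epsilon> \<omega>)
                       (\<lambda>\<omega>. a * C \<omega> + \<theta> * sqrt (1 - a\<^sup>2) * \<epsilon> \<omega>))"
proof -
  interpret cauchy_rademacher M C \<epsilon>
    using assms by (simp add: cauchy_rademacher_def cauchy_rademacher_axioms_def)
  show ?thesis
    by (auto simp: abs_le_iff intro!: eq_in_law_scaled eq_in_law_shifted)
qed

end
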